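(* Let $\lambda$ be a real number with $\lambda>-1$, $\lambda\neq0$, and let $x$ be a real number (or an indeterminate). For every positive integer $n$, \[ \mathrm{Bel}_{n,\lambda}(x)=\sum_{m=0}^{n}S_{2}(n,m\mid\lambda)\left(\frac{\log(1+\lambda)}{\lambda}\right)^{m}x^{m}, \] where the degenerate Stirling numbers of the second kind satisfy \[ S_{2}(n,m\mid\lambda)=\sum_{k=m}^{n}S_{1}(n,k)S_{2}(k,m)\lambda^{n-k}\qquad\text{for }0\le m\le n. \]
   Context: The degenerate Bell polynomials $\mathrm{Bel}_{n,\lambda}(x)$ are defined by \[ (1+\lambda)^{\frac{x}{\lambda}\left((1+\lambda t)^{1/\lambda}-1\right)}=\exp\!\Big(\tfrac{x}{\lambda}\log(1+\lambda)\big((1+\lambda t)^{1/\lambda}-1\big)\Big)=\sum_{n=0}^{\infty}\mathrm{Bel}_{n,\lambda}(x)\frac{t^{n}}{n!}, \] with $(1+\lambda t)^{1/\lambda}=\exp(\tfrac1\lambda\log(1+\lambda t))$. The degenerate Stirling numbers of the second kind $S_2(m,n\mid\lambda)$ are defined by \[ \Big(e^{\frac{1}{\lambda}\log(1+\lambda t)}-1\Big)^{n}=n!\sum_{m=n}^{\infty}S_{2}(m,n\mid\lambda)\frac{t^{m}}{m!}. \] $S_1(n,l)$ are the (signed) Stirling numbers of the first kind, defined by $x(x-1)\cdots(x-n+1)=\sum_{l=0}^{n}S_1(n,l)x^l$, and $S_2(n,l)$ are the Stirling numbers of the second kind, defined by $x^n=\sum_{l=0}^{n}S_2(n,l)\,x(x-1)\cdots(x-l+1)$.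 *)

theory Defs
  imports
    Complex_Main
    "HOL-Computational_Algebra.Polynomial"
    "HOL-Computational_Algebra.Formal_Power_Series"
    "HOL-Combinatorics.Stirling"
begin

text \<open>
  The library's \<open>stirling\<close> is the unsigned version, so the signed Stirling numbers of the first
  kind are introduced as the coefficients of the falling factorial.  The library's \<open>Stirling\<close> is
  the number of the second kind; it is defined by recursion, and \<open>Stirling_falling_factorial\<close>
  below recovers the expansion of powers in falling factorials.
\<close>

definition signed_stirling1 :: "nat \<Rightarrow> nat \<Rightarrow> int" where
  "signed_stirling1 n l = coeff (\<Prod>i<n. [:- int i, 1:]) l"

lemma degree_falling_factorial_poly: "degree (\<Prod>i<n. [:- int i, 1:]) = n"
  by (subst degree_prod_eq_sum_degree) auto

lemma signed_stirling1_falling_factorial: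
  fixes x :: real
  shows "(\<Prod>i<n. x - real i) = (\<Sum>l\<le>n. of_int (signed_stirling1 n l) * x ^ l)"
proof -
  have eq: "(\<Prod>i<n. [:- real i, 1:]) = map_poly real_of_int (\<Prod>i<n. [:- int i, 1:])"
  proof (induction n)
    case 0
    show ?case by (simp add: map_poly_1)
  next
    case (Suc n)
    show ?case
      by (simp only: prod.lessThan_Suc Suc.IH)
         (rule poly_eqI, simp add: coeff_map_poly coeff_pCons split: nat.split)
  qed
  have "(\<Prod>i<n. x - real i) = poly (\<Prod>i<n. [:- real i, 1:]) x"
    by (simp add: poly_prod)
  also have "\<dots> = (\<Sum>l\<le>n. of_int (signed_stirling1 n l) * x ^ l)"
    unfolding eq
    by (simp add: poly_altdef degree_map_poly degree_falling_factorial_poly coeff_map_poly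
        signed_stirling1_def)
  finally show ?thesis .
qed

lemma Stirling_falling_factorial:
  fixes x :: real
  shows "x ^ n = (\<Sum>l\<le>n. real (Stirling n l) * (\<Prod>i<l. x - real i))"
proof (induction n)
  case 0
  show ?case by simp
next
  case (Suc n)
  let ?f = "\<lambda>l. \<Prod>i<l. x - real i"
  have "x ^ Suc n = (\<Sum>l\<le>n. real (Stirling n l) * (?f (Suc l) + real l * ?f l))"
    by (simp only: power_Suc Suc.IH sum_distrib_left) (intro sum.cong refl, simp add: algebra_simps)
  also have "\<dots> = (\<Sum>l\<le>n. real (Stirling n l) * ?f (Suc l)) + (\<Sum>l\<le>n. real (l * Stirling n l) * ?f l)"
    by (simp only: sum.distrib [symmetric]) (intro sum.cong refl, simp add: distrib_left)
  also have "(\<Sum>l\<le>n. real (l * Stirling n l) * ?f l) = (\<Sum>l\<le>Suc n. real (l * Stirling n l) * ?f l)"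
    by simp
  also have "\<dots> = (\<Sum>l\<le>n. real (Suc l * Stirling n (Suc l)) * ?f (Suc l))"
    by (subst sum.atMost_Suc_shift) simp
  also have "(\<Sum>l\<le>n. real (Stirling n l) * ?f (Suc l)) + \<dots> =
      (\<Sum>l\<le>n. real (Stirling (Suc n) (Suc l)) * ?f (Suc l))"
    by (simp add: sum.distrib [symmetric] algebra_simps del: prod.lessThan_Suc)
  also have "\<dots> = (\<Sum>l\<le>Suc n. real (Stirling (Suc n) l) * ?f l)"
    by (simp only: sum.atMost_Suc_shift) simp
  finally show ?case .
qed

text \<open>
  Generating functions are formal power series in \<open>t\<close>.  The series of \<open>log (1 + t)\<close> is
  \<open>fps_ln 1\<close>, and \<open>degenerate_exp lam\<close> is \<open>(1 + lam t)\<^bsup>1/lam\<^esup> = exp (log (1 + lam t) / lam)\<close>.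
\<close>

definition degenerate_exp :: "real \<Rightarrow> real fps" where
  "degenerate_exp lam =
     fps_exp 1 oo (fps_const (1 / lam) * (fps_ln 1 oo (fps_const lam * fps_X)))"

definition degenerate_Stirling2 :: "nat \<Rightarrow> nat \<Rightarrow> real \<Rightarrow> real" where
  "degenerate_Stirling2 m n lam = fact m / fact n * fps_nth ((degenerate_exp lam - 1) ^ n) m"

definition degenerate_Bell :: "nat \<Rightarrow> real \<Rightarrow> real \<Rightarrow> real" where
  "degenerate_Bell n lam x =
     fact n * fps_nth (fps_exp 1 oo (fps_const (x / lam * ln (1 + lam)) * (degenerate_exp lam - 1))) n"

text \<open>
  The same generating function with \<open>x\<close> an indeterminate, so that the coefficients of the power
  series in \<open>t\<close> are polynomials in \<open>x\<close>.  The constant \<open>fps_exp\<close> is not available over polynomial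
  rings, because it requires coefficients in a field.
\<close>

definition degenerate_Bell_poly :: "nat \<Rightarrow> real \<Rightarrow> real poly" where
  "degenerate_Bell_poly n lam =
     smult (fact n) (fps_nth
       (Abs_fps (\<lambda>k. [:1 / fact k:]) oo
         (fps_const [:0, 1 / lam * ln (1 + lam):] *
            Abs_fps (\<lambda>k. [:fps_nth (degenerate_exp lam - 1) k:]))) n)"

lemma degenerate_exp_nth_0 [simp]: "fps_nth (degenerate_exp lam) 0 = 1"
  by (simp add: degenerate_exp_def fps_compose_nth)

lemma degenerate_Stirling2_generating_function:
  "(degenerate_exp lam - 1) ^ n =
     fps_const (fact n) * Abs_fps (\<lambda>m. if m < n then 0 else degenerate_Stirling2 m n lam / fact m)"
  by (rule fps_ext) (auto simp: degenerate_Stirling2_def startsby_zero_power_prefix)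

lemma degenerate_Bell_generating_function:
  "fps_exp 1 oo (fps_const (x / lam * ln (1 + lam)) * (degenerate_exp lam - 1)) =
     Abs_fps (\<lambda>n. degenerate_Bell n lam x / fact n)"
  by (rule fps_ext) (simp add: degenerate_Bell_def)

lemma poly_degenerate_Bell_poly: "poly (degenerate_Bell_poly n lam) x = degenerate_Bell n lam x"
proof -
  let ?F = "fps_const [:0, 1 / lam * ln (1 + lam):] *
              Abs_fps (\<lambda>k. [:fps_nth (degenerate_exp lam - 1) k:])"
  let ?G = "fps_const (x / lam * ln (1 + lam)) * (degenerate_exp lam - 1)"
  have "poly (fps_nth (?F ^ i) k) x = fps_nth (?G ^ i) k" for i k
  proof (induction i arbitrary: k)
    case 0
    show ?case by (simp add: fps_one_nth)
  next
    case (Suc i)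
    have "poly (fps_nth ?F j) x = fps_nth ?G j" for j
      by (simp add: algebra_simps)
    then show ?case
      by (simp only: power_Suc fps_mult_nth[of ?F] fps_mult_nth[of ?G] poly_sum poly_mult Suc.IH)
  qed
  then show ?thesis
    by (simp add: degenerate_Bell_poly_def degenerate_Bell_def fps_compose_nth poly_sum)
qed

end

theory Submission
  imports Defs
begin

text \<open>
  The series \<open>D = (1 + lam t)\<^bsup>1/lam\<^esup>\<close> satisfies \<open>(1 + lam t) D' = D\<close>.  Hence
  \<open>(1 + lam t) ((D - 1)\<^sup>m)' = m ((D - 1)\<^sup>m + (D - 1)\<^bsup>m-1\<^esup>)\<close>, which on coefficients is the recurrence
  \<open>T (n+1) m = (m - lam n) T n m + T n (m-1)\<close>.  The sums over products of Stirling numbers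
  satisfy the same recurrence.  The formula for the Bell polynomials is the exponential series of
  \<open>c (D - 1)\<close> read off coefficientwise.
\<close>

lemma signed_stirling1_0: "signed_stirling1 0 k = (if k = 0 then 1 else 0)"
  by (simp add: signed_stirling1_def)

lemma signed_stirling1_Suc_0: "signed_stirling1 (Suc n) 0 = - int n * signed_stirling1 n 0"
  by (simp add: signed_stirling1_def mult.commute coeff_mult)

lemma signed_stirling1_Suc_Suc:
  "signed_stirling1 (Suc n) (Suc k) = signed_stirling1 n k - int n * signed_stirling1 n (Suc k)"
  by (simp add: signed_stirling1_def mult.commute[of "prod _ _"])

lemma signed_stirling1_less: "n < k \<Longrightarrow> signed_stirling1 n k = 0"
  by (simp add: signed_stirling1_def coeff_eq_0 degree_falling_factorial_poly)

text \<open>The recurrence of \<open>signed_stirling1\<close> splits \<open>R (Suc n) m\<close> into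
  a sum with \<open>k\<close> shifted by one and \<open>- real n\<close> times an unshifted sum; the
  recurrence of \<open>Stirling\<close> then expands \<open>Stirling (Suc k) m\<close> in the
  shifted one.\<close>

lemma Stirling_sum_Suc:
  fixes lam :: real
  defines "R \<equiv> \<lambda>n m. \<Sum>k\<le>n. of_int (signed_stirling1 n k) * real (Stirling k m) * lam ^ (n - k)"
  shows "R (Suc n) m = (real m - lam * real n) * R n m + (if m = 0 then 0 else R n (m - 1))"
proof -
  have St: "real (Stirling (Suc k) m) =
      real m * real (Stirling k m) + (if m = 0 then 0 else real (Stirling k (m - 1)))" for k
    by (cases m) (auto simp: algebra_simps)
  have "R (Suc n) m =
      (\<Sum>k\<le>n. of_int (signed_stirling1 n k) * real (Stirling (Suc k) m) * lam ^ (n - k))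
      - real n * (\<Sum>k\<le>Suc n. of_int (signed_stirling1 n k) * real (Stirling k m) * lam ^ (Suc n - k))"
    unfolding R_def
    by (simp only: sum.atMost_Suc_shift signed_stirling1_Suc_Suc signed_stirling1_Suc_0 diff_Suc_Suc)
       (simp add: algebra_simps sum.distrib sum_subtractf sum_distrib_left)
  \<comment> \<open>The top term vanishes since \<open>signed_stirling1 n (Suc n) = 0\<close>; every
    other term carries one extra factor \<open>lam\<close>.\<close>
  also have "(\<Sum>k\<le>Suc n. of_int (signed_stirling1 n k) * real (Stirling k m) * lam ^ (Suc n - k)) =
      lam * R n m"
    unfolding R_def
    by (simp add: signed_stirling1_less sum_distrib_left Suc_diff_le mult_ac)
  also have "(\<Sum>k\<le>n. of_int (signed_stirling1 n k) * real (Stirling (Suc k) m) * lam ^ (n - k)) =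
      real m * R n m + (if m = 0 then 0 else R n (m - 1))"
    unfolding R_def St
    by (simp add: algebra_simps sum.distrib sum_distrib_left)
  finally show ?thesis by (simp add: algebra_simps)
qed

text \<open>Writing the series as \<open>exp H\<close> with
  \<open>H = log (1 + lam t) / lam\<close>, the chain rule leaves only
  \<open>H' = 1 / (1 + lam t)\<close>, a geometric series.\<close>

lemma degenerate_exp_ODE:
  assumes "lam \<noteq> 0"
  shows "(1 + fps_const lam * fps_X) * fps_deriv (degenerate_exp lam) = degenerate_exp lam"
proof -
  define H where "H = fps_const (1 / lam) * (fps_ln 1 oo (fps_const lam * fps_X))"
  have "fps_nth (fps_deriv H) k = (- lam) ^ k" for k
  proof -
    have "fps_nth (fps_deriv H) k =
        real (Suc k) * (1 / lam * (lam ^ Suc k * ((- 1) ^ k / real (Suc k))))"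
      by (simp add: H_def fps_compose_linear fps_ln_nth del: of_nat_Suc)
    also have "\<dots> = (- 1) ^ k * lam ^ k"
      using assms by (simp del: of_nat_Suc)
    also have "\<dots> = (- lam) ^ k"
      by (rule power_minus[symmetric])
    finally show ?thesis .
  qed
  then have "fps_deriv H = Abs_fps (\<lambda>k. (- lam) ^ k)"
    by (intro fps_ext) (simp only: fps_nth_Abs_fps)
  then have "fps_nth ((1 + fps_const lam * fps_X) * fps_deriv H) k = fps_nth 1 k" for k
    \<comment> \<open>For \<open>k > 0\<close> the coefficients \<open>(- lam) ^ k\<close> and
      \<open>lam * (- lam) ^ (k - 1)\<close> cancel.\<close>
    by (cases k) (simp_all add: distrib_right mult.assoc)
  then have "(1 + fps_const lam * fps_X) * fps_deriv H = 1"
    by (rule fps_ext)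
  moreover have "fps_deriv (degenerate_exp lam) = degenerate_exp lam * fps_deriv H"
    unfolding degenerate_exp_def H_def[symmetric]
    by (subst fps_compose_deriv) (simp_all add: H_def)
  ultimately show ?thesis
    by (metis mult.left_commute mult.right_neutral)
qed

lemma degenerate_Stirling2_Suc:
  assumes "lam \<noteq> 0"
  shows "degenerate_Stirling2 (Suc n) m lam = (real m - lam * real n) * degenerate_Stirling2 n m lam
    + (if m = 0 then 0 else degenerate_Stirling2 n (m - 1) lam)"
proof (cases m)
  case 0
  then show ?thesis by (simp add: degenerate_Stirling2_def fps_one_nth)
next
  case (Suc j)
  let ?D = "degenerate_exp lam - 1"
  have "(1 + fps_const lam * fps_X) * fps_deriv (?D ^ Suc j) =
      fps_const (real (Suc j)) * ?D ^ j * ((1 + fps_const lam * fps_X) * fps_deriv (degenerate_exp lam))"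
    by (simp only: fps_deriv_power fps_deriv_sub fps_deriv_1 diff_zero diff_Suc_1 mult_ac)
  \<comment> \<open>The remaining factor \<open>degenerate_exp lam\<close> is split as
    \<open>?D + 1\<close>.\<close>
  also have "\<dots> = fps_const (real (Suc j)) * (?D ^ Suc j + ?D ^ j)"
    unfolding degenerate_exp_ODE[OF assms] power_Suc by algebra
  finally have "fps_nth ((1 + fps_const lam * fps_X) * fps_deriv (?D ^ Suc j)) n =
      fps_nth (fps_const (real (Suc j)) * (?D ^ Suc j + ?D ^ j)) n"
    by simp
  then have "real (Suc n) * fps_nth (?D ^ Suc j) (Suc n) =
      (real (Suc j) - lam * real n) * fps_nth (?D ^ Suc j) n + real (Suc j) * fps_nth (?D ^ j) n"
    by (cases n) (simp_all add: distrib_right mult.assoc algebra_simps del: power_Suc)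
  \<comment> \<open>This factor restores the normalisation: \<open>Suc n\<close> is absorbed into
    \<open>fact (Suc n)\<close>, and \<open>Suc j\<close> cancels to leave
    \<open>fact j\<close>.\<close>
  then have "fact n / fact (Suc j) * (real (Suc n) * fps_nth (?D ^ Suc j) (Suc n)) =
      fact n / fact (Suc j) * ((real (Suc j) - lam * real n) * fps_nth (?D ^ Suc j) n
        + real (Suc j) * fps_nth (?D ^ j) n)"
    by (rule arg_cong)
  then show ?thesis
    unfolding degenerate_Stirling2_def Suc
    by (simp add: distrib_left mult_ac del: power_Suc of_nat_Suc)
qed

text \<open>Both sides obey the same recurrence and agree at \<open>n = 0\<close>. The summation
  range does not depend on \<open>m\<close>, so the induction covers all \<open>m\<close> without
  boundary cases.\<close>

lemma degenerate_Stirling2_eq_sum: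
  assumes "lam \<noteq> 0"
  shows "degenerate_Stirling2 n m lam =
    (\<Sum>k\<le>n. of_int (signed_stirling1 n k) * real (Stirling k m) * lam ^ (n - k))"
proof (induction n arbitrary: m)
  case 0
  show ?case
    by (cases m) (simp_all add: degenerate_Stirling2_def signed_stirling1_0)
next
  case (Suc n)
  show ?case
    by (simp only: degenerate_Stirling2_Suc[OF assms] Stirling_sum_Suc Suc.IH)
qed

lemma degenerate_Bell_eq_sum:
  "degenerate_Bell n lam x =
    (\<Sum>m\<le>n. degenerate_Stirling2 n m lam * (ln (1 + lam) / lam) ^ m * x ^ m)"
  unfolding degenerate_Bell_def degenerate_Stirling2_def fps_compose_nth sum_distrib_left
    power_mult_distrib fps_const_power fps_mult_left_const_nth atLeast0AtMost
  by (intro sum.cong) (simp_all add: power_mult_distrib power_divide)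

theorem theorem3:
  fixes lam :: real and n :: nat
  assumes "lam > -1" and "lam \<noteq> 0" and "n > 0"
  shows "(\<forall>x. degenerate_Bell n lam x =
             (\<Sum>m\<le>n. degenerate_Stirling2 n m lam * (ln (1 + lam) / lam) ^ m * x ^ m))
       \<and> degenerate_Bell_poly n lam =
             (\<Sum>m\<le>n. monom (degenerate_Stirling2 n m lam * (ln (1 + lam) / lam) ^ m) m)
       \<and> (\<forall>m\<le>n. degenerate_Stirling2 n m lam =
             (\<Sum>k=m..n. of_int (signed_stirling1 n k) * real (Stirling k m) * lam ^ (n - k)))"
proof (intro conjI allI impI)
  show "degenerate_Bell n lam x =
      (\<Sum>m\<le>n. degenerate_Stirling2 n m lam * (ln (1 + lam) / lam) ^ m * x ^ m)" for x
    by (rule degenerate_Bell_eq_sum)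
  show "degenerate_Bell_poly n lam =
      (\<Sum>m\<le>n. monom (degenerate_Stirling2 n m lam * (ln (1 + lam) / lam) ^ m) m)"
    \<comment> \<open>Real polynomials that agree at every point are equal.\<close>
    by (subst poly_eq_poly_eq_iff[symmetric], rule ext)
       (simp only: poly_degenerate_Bell_poly degenerate_Bell_eq_sum poly_sum poly_monom)
  show "degenerate_Stirling2 n m lam =
      (\<Sum>k=m..n. of_int (signed_stirling1 n k) * real (Stirling k m) * lam ^ (n - k))" for m
    unfolding degenerate_Stirling2_eq_sum[OF assms(2)]
    \<comment> \<open>The terms with \<open>k < m\<close> drop out because
      \<open>Stirling k m = 0\<close> there.\<close>
    by (rule sum.mono_neutral_right) (auto simp: not_le)
qed

end
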